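(* For all integers $n\ge1$ and $k\ge1$, the residue of $\mathfrak B_{2n}^{(-k)}$ modulo $5$ depends only on $n \bmod 2$ and $k\bmod 4$, as follows: if $n$ is even, $\mathfrak B_{2n}^{(-k)}\equiv 3,4,2,1\pmod 5$ according as $k\equiv 0,1,2,3\pmod 4$; if $n$ is odd, $\mathfrak B_{2n}^{(-k)}\equiv 2,1,3,4\pmod 5$ according as $k\equiv 0,1,2,3\pmod 4$.
   Context: For an integer $k$, the poly-Bernoulli numbers with level $2$, $\mathfrak B_n^{(k)}$, are defined by the power series identity $$\sum_{n=0}^\infty\mathfrak B_n^{(k)}\frac{x^n}{n!}=\frac{{\rm Li}_{2,k}\bigl(2\sin(x/2)\bigr)}{2\sin(x/2)}=\sum_{m=0}^\infty\frac{\bigl(2\sin(x/2)\bigr)^{2m}}{(2m+1)^k},$$ where ${\rm Li}_{2,k}(z)=\sum_{n=0}^\infty\frac{z^{2n+1}}{(2n+1)^k}$. For $k\le 0$ these numbers are integers. *)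

theory Defs
  imports "HOL-Computational_Algebra.Formal_Power_Series" "HOL-Number_Theory.Cong"
begin

definition Li2 :: "int \<Rightarrow> rat fps" where
  "Li2 k = Abs_fps (\<lambda>j. if odd j then 1 / (of_nat j powi k) else 0)"

definition two_sin_half :: "rat fps" where
  "two_sin_half = fps_const 2 * fps_sin (1 / 2)"

(* fps_compose is only meaningful when the inner series has zero constant term, which holds here.
   The quotient is the library division of formal power series; it is exact, since
   Li2 k is divisible by fps_X (see poly_bernoulli2_gf_altdef). *)
definition poly_bernoulli2_gf :: "int \<Rightarrow> rat fps" where
  "poly_bernoulli2_gf k = (Li2 k oo two_sin_half) / two_sin_half"

definition poly_bernoulli2 :: "nat \<Rightarrow> int \<Rightarrow> rat" where
  "poly_bernoulli2 n k = fact n * fps_nth (poly_bernoulli2_gf k) n"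

lemma two_sin_half_nth_0 [simp]: "fps_nth two_sin_half 0 = 0"
  by (simp add: two_sin_half_def)

lemma two_sin_half_nonzero: "two_sin_half \<noteq> 0"
proof
  assume "two_sin_half = 0"
  then have "fps_nth two_sin_half 1 = 0" by simp
  then show False by (simp add: two_sin_half_def fps_sin_def)
qed

lemma poly_bernoulli2_gf_altdef:
  "poly_bernoulli2_gf k =
     Abs_fps (\<lambda>m. 1 / (of_nat (2 * m + 1) powi k)) oo two_sin_half ^ 2"
proof -
  let ?F = "Abs_fps (\<lambda>m. 1 / (of_nat (2 * m + 1) powi k)) :: rat fps"
  have nth: "fps_nth (?F oo fps_X ^ 2) j = (if even j then 1 / (of_nat (j + 1) powi k) else 0)"
    for j
  proof -
    have "fps_nth (?F oo fps_X ^ 2) j =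
        (\<Sum>i\<in>{0..j}. if j = 2 * i then 1 / (of_nat (2 * i + 1) powi k) else 0)"
      unfolding fps_compose_nth by (intro sum.cong) (auto simp flip: power_mult)
    also have "\<dots> = (if even j then 1 / (of_nat (j + 1) powi k) else 0)"
      by (auto elim!: evenE intro!: sum.neutral)
    finally show ?thesis .
  qed
  have "Li2 k = fps_X * (?F oo fps_X ^ 2)"
  proof (rule fps_ext)
    fix j
    show "fps_nth (Li2 k) j = fps_nth (fps_X * (?F oo fps_X ^ 2)) j"
      unfolding fps_X_mult_nth nth by (cases j) (auto simp: Li2_def)
  qed
  then have "Li2 k oo two_sin_half = two_sin_half * ((?F oo fps_X ^ 2) oo two_sin_half)"
    by (simp add: fps_compose_mult_distrib)
  also have "(?F oo fps_X ^ 2) oo two_sin_half = ?F oo (fps_X ^ 2 oo two_sin_half)"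
    by (rule fps_compose_assoc [symmetric]) simp_all
  also have "fps_X ^ 2 oo two_sin_half = two_sin_half ^ 2"
    by (simp add: fps_X_power_compose)
  finally show ?thesis
    by (simp add: poly_bernoulli2_gf_def two_sin_half_nonzero)
qed

end

theory Submission
  imports Defs
begin

text \<open>
  Since the series \<open>s = 2 sin (x / 2)\<close> satisfies \<open>s'\<^sup>2 = 1 - s\<^sup>2 / 4\<close> and \<open>s'' = - s / 4\<close>, the coefficients
  \<open>t(n, m) = (2 n)! [x\<^bsup>2n\<^esup>] s\<^bsup>2m\<^esup>\<close> obey
  \<open>t(n + 1, m) = 2 m (2 m - 1) t(n, m - 1) - m\<^sup>2 t(n, m)\<close>; in particular they are integers, and the number
  in question is the sum of all \<open>(2 m + 1)\<^sup>k t(n, m)\<close>. The factor \<open>2 m (2 m - 1)\<close> is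
  divisible by 5 at \<open>m = 3\<close>, so \<open>t(n, m)\<close> vanishes modulo 5 for all \<open>m \<ge> 3\<close>; the term \<open>m = 2\<close> is killed by
  \<open>5\<^sup>k\<close>, and the term \<open>m = 0\<close> is zero. What is left is \<open>3\<^sup>k t(n, 1) = 2 (-1)\<^bsup>n-1\<^esup> 3\<^sup>k\<close>.
\<close>

fun sin_power_coeff :: "nat \<Rightarrow> nat \<Rightarrow> int" where
  "sin_power_coeff 0 m = (if m = 0 then 1 else 0)"
| "sin_power_coeff (Suc n) 0 = 0"
| "sin_power_coeff (Suc n) (Suc m) =
     (2 * int m + 2) * (2 * int m + 1) * sin_power_coeff n m
       - (int m + 1)\<^sup>2 * sin_power_coeff n (Suc m)"

lemma fps_deriv_two_sin_half: "fps_deriv two_sin_half = fps_cos (1 / 2)"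
  by (simp add: two_sin_half_def fps_sin_deriv flip: mult.assoc)

lemma fps_deriv2_two_sin_half:
  "fps_deriv (fps_deriv two_sin_half) = - fps_const (1 / 4) * two_sin_half"
  unfolding fps_deriv_two_sin_half
  by (simp add: two_sin_half_def fps_cos_deriv flip: mult.assoc fps_const_neg)

lemma fps_deriv_two_sin_half_square:
  "(fps_deriv two_sin_half)\<^sup>2 = 1 - fps_const (1 / 4) * two_sin_half\<^sup>2"
proof -
  have "fps_const (1 / 4) * two_sin_half\<^sup>2 = (fps_sin (1 / 2))\<^sup>2"
    by (simp add: two_sin_half_def power_mult_distrib fps_const_power flip: mult.assoc)
  then show ?thesis
    using fps_sin_cos_sum_of_squares[of "1 / 2 :: rat"]
    by (simp add: fps_deriv_two_sin_half algebra_simps)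
qed

text \<open>Differentiating twice gives (2m+2)(2m+1) s^(2m) s'^2 + (2m+2) s^(2m+1) s''. Eliminating
  s'^2 and s'' leaves -(1/4)(2m+2)((2m+1) + 1) = -(m+1)^2 as the coefficient of s^(2m+2).\<close>

lemma fps_deriv2_two_sin_half_power:
  "fps_deriv (fps_deriv (two_sin_half ^ (2 * Suc m))) =
     fps_const (of_int ((2 * int m + 2) * (2 * int m + 1))) * two_sin_half ^ (2 * m)
       - fps_const (of_int ((int m + 1)\<^sup>2)) * two_sin_half ^ (2 * Suc m)"
proof -
  let ?s = two_sin_half and ?d = "fps_deriv two_sin_half"
  have deriv: "fps_deriv (?s ^ Suc j) = of_nat (Suc j) * (?s ^ j * ?d)" for j
    by (simp only: fps_deriv_power' diff_Suc_1 fps_of_nat mult_ac)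
  have "fps_deriv (?s ^ (2 * Suc m)) = of_nat (2 * m + 2) * (?s ^ Suc (2 * m) * ?d)"
    using deriv[of "2 * m + 1"] by simp
  then have "fps_deriv (fps_deriv (?s ^ (2 * Suc m))) =
      of_nat (2 * m + 2) * (of_nat (2 * m + 1) * ?s ^ (2 * m) * ?d\<^sup>2
        + ?s ^ (2 * m + 1) * fps_deriv ?d)"
    by (simp only: fps_deriv_mult fps_deriv_of_nat deriv) (simp add: algebra_simps power2_eq_square)
  also have "\<dots> = of_nat (2 * m + 2) * of_nat (2 * m + 1) * ?s ^ (2 * m)
      - fps_const (1 / 4) * of_nat (2 * m + 2) * of_nat (2 * m + 2) * ?s ^ (2 * Suc m)"
    unfolding fps_deriv_two_sin_half_square fps_deriv2_two_sin_half
    by (simp add: algebra_simps power2_eq_square flip: fps_const_neg)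
  also have "of_nat (2 * m + 2) * of_nat (2 * m + 1) =
      (fps_const (of_int ((2 * int m + 2) * (2 * int m + 1))) :: rat fps)"
    by (simp add: algebra_simps flip: fps_of_nat)
  also have "fps_const (1 / 4) * of_nat (2 * m + 2) * of_nat (2 * m + 2) =
      (fps_const (of_int ((int m + 1)\<^sup>2)) :: rat fps)"
    unfolding fps_of_nat [symmetric] fps_const_mult
    by (rule arg_cong [of _ _ fps_const]) (simp add: power2_eq_square field_simps)
  finally show ?thesis .
qed

lemma fact_mult_fps_nth_add_2:
  fixes f :: "'a :: {comm_semiring_1, semiring_char_0} fps"
  shows "fact (Suc (Suc n)) * fps_nth f (Suc (Suc n)) = fact n * fps_nth (fps_deriv (fps_deriv f)) n"
  by (simp add: mult_ac)

text \<open>Comparing coefficients in the differential equation for s^(2m+2) yields the recurrence.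
  Up to sign, these integers are (2m)! times the central factorial numbers T(2n,2m).\<close>

lemma two_sin_half_power_nth:
  "fact (2 * n) * fps_nth (two_sin_half ^ (2 * m)) (2 * n) = of_int (sin_power_coeff n m)"
proof (induction n m rule: sin_power_coeff.induct)
  case (1 m)
  then show ?case by (simp add: fps_nth_power_0)
next
  case (2 n)
  then show ?case by simp
next
  case (3 n m)
  have "fact (2 * Suc n) * fps_nth (two_sin_half ^ (2 * Suc m)) (2 * Suc n) =
      fact (2 * n) * fps_nth (fps_deriv (fps_deriv (two_sin_half ^ (2 * Suc m)))) (2 * n)"
    unfolding fact_mult_fps_nth_add_2 [symmetric] by (simp only: mult_Suc_right add_2_eq_Suc)
  also have "\<dots> = of_int ((2 * int m + 2) * (2 * int m + 1)) *
        (fact (2 * n) * fps_nth (two_sin_half ^ (2 * m)) (2 * n))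
      - of_int ((int m + 1)\<^sup>2) *
        (fact (2 * n) * fps_nth (two_sin_half ^ (2 * Suc m)) (2 * n))"
    unfolding fps_deriv2_two_sin_half_power fps_sub_nth fps_mult_left_const_nth
    by (simp only: right_diff_distrib mult.left_commute)
  also have "\<dots> = of_int (sin_power_coeff (Suc n) (Suc m))"
    unfolding 3 by simp
  finally show ?case .
qed

text \<open>The exponent -k turns the denominators into factors (2m+1)^k. The bound 2n comes from
  the formula for coefficients of a composition; the terms with m > n vanish.\<close>

lemma poly_bernoulli2_eq_sum:
  "poly_bernoulli2 (2 * n) (- int k) =
     of_int (\<Sum>m = 0..2 * n. (2 * int m + 1) ^ k * sin_power_coeff n m)"
  by (simp add: poly_bernoulli2_def poly_bernoulli2_gf_altdef fps_compose_nth sum_distrib_left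
      power_int_minus_divide mult.left_commute add.commute[of 1] flip: two_sin_half_power_nth power_mult)

lemma sin_power_coeff_Suc_1: "sin_power_coeff (Suc n) (Suc 0) = 2 * (-1) ^ n"
  by (induction n) simp_all

lemma five_dvd_sin_power_coeff: "m \<ge> 3 \<Longrightarrow> 5 dvd sin_power_coeff n m"
proof (induction n m rule: sin_power_coeff.induct)
  case (3 n m)
  have "5 dvd (2 * int m + 2) * (2 * int m + 1) * sin_power_coeff n m"
  \<comment> \<open>The recurrence computes the entry at \<open>Suc m\<close>. For m = 2 no
    induction hypothesis applies to column m, but the factor 2m+1 is 5.\<close>
  proof (cases "m = 2")
    case True
    then show ?thesis by simp
  next
    case False
    with 3 show ?thesis by simp
  qed
  with 3 show ?case by simp
qed auto

lemma sum_sin_power_coeff_cong: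
  assumes "n \<ge> 1" and "k \<ge> 1"
  shows "[(\<Sum>m = 0..2 * n. (2 * int m + 1) ^ k * sin_power_coeff n m) =
    2 * (-1) ^ (n - 1) * 3 ^ k] (mod 5)"
proof -
  let ?f = "\<lambda>m. (2 * int m + 1) ^ k * sin_power_coeff n m"
  obtain n' where n: "n = Suc n'"
    using assms by (cases n) auto
  have "5 dvd ?f m" if "m \<noteq> 1" for m
  proof -
    \<comment> \<open>Column 0 vanishes because n > 0, and m = 2 contributes the factor 5^k with k >
      0.\<close>
    consider "m = 0" | "m = 2" | "m \<ge> 3"
      using \<open>m \<noteq> 1\<close> by linarith
    then show ?thesis
      by cases (use assms n in \<open>auto simp: five_dvd_sin_power_coeff\<close>)
  qed
  then have "5 dvd sum ?f ({0..2 * n} - {1})"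
    by (intro dvd_sum) auto
  moreover have "sum ?f {0..2 * n} = ?f 1 + sum ?f ({0..2 * n} - {1})"
    using assms by (intro sum.remove) auto
  moreover have "?f 1 = 2 * (-1) ^ (n - 1) * 3 ^ k"
    by (simp add: n sin_power_coeff_Suc_1 del: sin_power_coeff.simps)
  ultimately show ?thesis
    by (simp add: cong_iff_dvd_diff)
qed

text \<open>This rests on 3^4 = 81, which is 1 modulo 5.\<close>

lemma power_3_cong_mod_4: "[3 ^ k = 3 ^ (k mod 4)] (mod (5 :: int))"
proof -
  have "[(3 ^ 4) ^ (k div 4) = 1 ^ (k div 4)] (mod (5 :: int))"
    by (rule cong_pow) (simp add: cong_def)
  from cong_mult [OF this cong_refl [of "3 ^ (k mod 4)"]] show ?thesis
    by (simp only: power_one mult_1 mult_div_mod_eq flip: power_mult power_add)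
qed

theorem theorem12:
  fixes n k :: nat
  assumes "n \<ge> 1" and "k \<ge> 1"
  shows "\<exists>b :: int. poly_bernoulli2 (2 * n) (- int k) = of_int b \<and>
    (even n \<longrightarrow>
      ([k = 0] (mod 4) \<longrightarrow> [b = 3] (mod 5)) \<and>
      ([k = 1] (mod 4) \<longrightarrow> [b = 4] (mod 5)) \<and>
      ([k = 2] (mod 4) \<longrightarrow> [b = 2] (mod 5)) \<and>
      ([k = 3] (mod 4) \<longrightarrow> [b = 1] (mod 5))) \<and>
    (odd n \<longrightarrow>
      ([k = 0] (mod 4) \<longrightarrow> [b = 2] (mod 5)) \<and>
      ([k = 1] (mod 4) \<longrightarrow> [b = 1] (mod 5)) \<and>
      ([k = 2] (mod 4) \<longrightarrow> [b = 3] (mod 5)) \<and>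
      ([k = 3] (mod 4) \<longrightarrow> [b = 4] (mod 5)))"
proof -
  define b where "b = (\<Sum>m = 0..2 * n. (2 * int m + 1) ^ k * sin_power_coeff n m)"
  have "[b = 2 * (-1) ^ (n - 1) * 3 ^ k] (mod 5)"
    unfolding b_def using assms by (rule sum_sin_power_coeff_cong)
  then have b: "[b = 2 * (-1) ^ (n - 1) * 3 ^ (k mod 4)] (mod 5)"
    by (rule cong_trans) (intro cong_mult cong_refl power_3_cong_mod_4)
  have sign: "(-1) ^ (n - 1) = (if even n then - 1 else 1 :: int)"
    using assms by (cases n) auto
  show ?thesis
  proof (intro exI [of _ b] conjI impI)
    show "poly_bernoulli2 (2 * n) (- int k) = of_int b"
      unfolding b_def by (rule poly_bernoulli2_eq_sum)
  \<comment> \<open>For k mod 4 = 0, 1, 2, 3 the values 2 * 3^(k mod 4) are 2, 1, 3, 4 modulo 5, as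
    required for odd n; negating them gives 3, 4, 2, 1 for even n.\<close>
  qed (use b sign in \<open>auto simp: cong_def\<close>)
qed

end
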